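(* Let $a(1)<a(2)<\cdots$ be the increasing enumeration of the positive integers $n$ with $\{n\sqrt2\}<\tfrac12$, and let $b(1)<b(2)<\cdots$ be the increasing enumeration of the positive integers $n$ with $\{n\sqrt2\}\ge\tfrac12$. For every integer $k>0$ there are infinitely many positive integers $j$ such that $b(j)-a(j)=k$.
   Context: $\{x\}=x-\lfloor x\rfloor$ denotes the fractional part of a real number $x$. (The sequences start $a=1,3,5,6,8,10,\dots$ and $b=2,4,7,9,11,12,\dots$.) *)

theory Defs
  imports "HOL-Analysis.Analysis"
begin

definition setA :: "nat set" where
  "setA = {n. n > 0 \<and> frac (real n * sqrt 2) < 1 / 2}"

definition setB :: "nat set" where
  "setB = {n. n > 0 \<and> frac (real n * sqrt 2) \<ge> 1 / 2}"

(* The library function enumerate is 0-based, whereas the sequences start at index 1;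
   the value at index 0 is irrelevant. *)
definition seq_a :: "nat \<Rightarrow> nat" where
  "seq_a j = enumerate setA (j - 1)"

definition seq_b :: "nat \<Rightarrow> nat" where
  "seq_b j = enumerate setB (j - 1)"

(* enumerate is only an increasing enumeration for infinite sets, so infinitude is shown here. *)

lemma sqrt2_bounds: "7 / 5 < sqrt 2" "sqrt 2 < 3 / 2"
  by (rule real_less_rsqrt, simp add: power2_eq_square)
     (rule real_less_lsqrt, simp_all add: power2_eq_square)

lemma frac_sqrt2_step:
  assumes "x = frac (real n * sqrt 2)"
  shows "frac (real (Suc n) * sqrt 2) = (if x + sqrt 2 < 2 then x + sqrt 2 - 1 else x + sqrt 2 - 2)"
proof -
  have "frac (sqrt 2) = sqrt 2 - 1"
    using sqrt2_bounds by (simp add: frac_unique_iff Ints_diff)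
  then show ?thesis
    using frac_add[of "real n * sqrt 2" "sqrt 2"] assms by (auto simp: algebra_simps)
qed

lemma infinite_setA: "infinite setA"
  unfolding infinite_nat_iff_unbounded
proof
  fix m
  define f where "f n = frac (real n * sqrt 2)" for n
  have "f (Suc m) < 1 / 2 \<or> f (Suc (Suc m)) < 1 / 2 \<or> f (Suc (Suc (Suc m))) < 1 / 2"
    using frac_sqrt2_step[OF refl, of "Suc m", folded f_def]
      frac_sqrt2_step[OF refl, of "Suc (Suc m)", folded f_def]
      sqrt2_bounds frac_lt_1[of "real (Suc m) * sqrt 2", folded f_def]
    by argo
  moreover have "m < Suc m" "m < Suc (Suc m)" "m < Suc (Suc (Suc m))"
    by simp_all
  ultimately show "\<exists>n>m. n \<in> setA"
    unfolding setA_def f_def by (metis (mono_tags, lifting) mem_Collect_eq zero_less_Suc)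
qed

lemma infinite_setB: "infinite setB"
  unfolding infinite_nat_iff_unbounded
proof
  fix m
  define f where "f n = frac (real n * sqrt 2)" for n
  have "f (Suc m) \<ge> 1 / 2 \<or> f (Suc (Suc m)) \<ge> 1 / 2 \<or> f (Suc (Suc (Suc m))) \<ge> 1 / 2"
    using frac_sqrt2_step[OF refl, of "Suc m", folded f_def]
      frac_sqrt2_step[OF refl, of "Suc (Suc m)", folded f_def]
      sqrt2_bounds frac_ge_0[of "real (Suc m) * sqrt 2", folded f_def]
    by argo
  moreover have "m < Suc m" "m < Suc (Suc m)" "m < Suc (Suc (Suc m))"
    by simp_all
  ultimately show "\<exists>n>m. n \<in> setB"
    unfolding setB_def f_def by (metis (mono_tags, lifting) mem_Collect_eq zero_less_Suc)
qed

lemma seq_a_enumerates: "strict_mono_on {1..} seq_a" "seq_a ` {1..} = setA"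
proof -
  show "strict_mono_on {1..} seq_a"
    by (auto simp: strict_mono_on_def seq_a_def intro!: enumerate_mono infinite_setA)
  have "(\<lambda>j. j - 1) ` {1..} = (UNIV :: nat set)"
    by (auto simp: image_iff intro!: bexI[where x = "Suc _"])
  then show "seq_a ` {1..} = setA"
    using range_enumerate[OF infinite_setA] by (metis (no_types, lifting) ext image_image seq_a_def)
qed

lemma seq_b_enumerates: "strict_mono_on {1..} seq_b" "seq_b ` {1..} = setB"
proof -
  show "strict_mono_on {1..} seq_b"
    by (auto simp: strict_mono_on_def seq_b_def intro!: enumerate_mono infinite_setB)
  have "(\<lambda>j. j - 1) ` {1..} = (UNIV :: nat set)"
    by (auto simp: image_iff intro!: bexI[where x = "Suc _"])
  then show "seq_b ` {1..} = setB"
    using range_enumerate[OF infinite_setB] by (metis (no_types, lifting) ext image_image seq_b_def)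
qed

end

theory Submission
  imports Defs
begin

text \<open>
Consider the walk that goes up at each index \<open>n\<close> with \<open>{n \<surd>2} < 1/2\<close> and down at the others, and
call its height before step \<open>n\<close> the excess of \<open>n\<close>. Let \<open>M\<close> be an up-step and \<open>M + k\<close> a down-step.
They have the same rank in the two sequences exactly if the excesses of \<open>M\<close> and \<open>M + k\<close> add up to
\<open>k + 2\<close> (one direction is \<open>balanced_pair_same_index\<close>), so the task is to find
infinitely many such \<open>M\<close>.

The key is a self-similarity. The unit \<open>3 - 2 \<surd>2\<close> acts on \<open>\<int>[\<surd>2]\<close> and induces a map \<open>inflate\<close> on
indices that multiplies fractional parts by \<open>3 - 2 \<surd>2\<close>. The walk observed along the inflated
indices is the original walk (\<open>excess_inflate\<close>). Two consequences:

\<^item> Each height \<open>e \<ge> 1\<close> is attained (\<open>excess_surj\<close>), and by iterated inflation it is attained at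
  infinitely many \<open>N\<close> with \<open>{N \<surd>2}\<close> arbitrarily small. After such an \<open>N\<close>, the walk repeats its own
  beginning, lifted by \<open>e\<close>, for as long as one wishes.

\<^item> For each \<open>k \<ge> 2\<close> some up-step \<open>n\<close> is followed at distance \<open>k\<close> by a down-step while the
  two heights are small, their sum being at most \<open>k\<close> (\<open>separating_pair\<close>). This is proved by
  descent on \<open>k\<close> through the inverse of inflation.

The missing amount is even, so lifting the pair by half of it gives \<open>M = N + n\<close> with the sum
exactly \<open>k + 2\<close>. The case \<open>k = 1\<close> escapes the second point and is settled by a pattern in the
blocks of the self-similarity that reproduces itself (\<open>infinitely_many_adjacent_pairs\<close>).
\<close>

section \<open>The walk and its inflation\<close>

definition pos :: "nat \<Rightarrow> real" where
  "pos n = frac (real n * sqrt 2)"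

definition side :: "nat \<Rightarrow> int" where
  "side n = (if pos n < 1 / 2 then 1 else - 1)"

text \<open>The summation includes the index 0, which belongs to neither sequence and has side 1. The walk
thus starts at a fixed point of inflation, which makes its heights exactly invariant.\<close>

definition excess :: "nat \<Rightarrow> int" where
  "excess n = (\<Sum>i<n. side i)"

definition whole :: "nat \<Rightarrow> nat" where
  "whole n = nat \<lfloor>real n * sqrt 2\<rfloor>"

text \<open>Multiplication of \<open>n \<surd>2 - m\<close>, where \<open>m = \<lfloor>n \<surd>2\<rfloor>\<close>, by the unit \<open>3 - 2 \<surd>2\<close> of
\<open>\<int>[\<surd>2]\<close> gives \<open>(3 n + 2 m) \<surd>2 - (4 n + 3 m)\<close>. The new coefficient of \<open>\<surd>2\<close> is the
inflation of \<open>n\<close>.\<close>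

definition inflate :: "nat \<Rightarrow> nat" where
  "inflate n = 3 * n + 2 * whole n"

section \<open>Arithmetic of fractional parts\<close>

lemma sqrt2_tight: "141 / 100 < sqrt 2" "sqrt 2 < 1415 / 1000"
  by (rule real_less_rsqrt, simp add: power2_eq_square)
     (rule real_less_lsqrt, simp_all add: power2_eq_square)

lemma pos_bounds: "0 \<le> pos n" "pos n < 1"
  by (simp_all add: pos_def frac_lt_1)

lemma whole_eq: "real (whole n) = real n * sqrt 2 - pos n"
proof -
  have "0 \<le> \<lfloor>real n * sqrt 2\<rfloor>" by simp
  then show ?thesis by (simp add: pos_def frac_def whole_def)
qed

lemma pos_eqI:
  assumes "real n * sqrt 2 = x + of_int c" "0 \<le> x" "x < 1"
  shows "pos n = x"
  unfolding pos_def frac_unique_iff using assms by simp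

lemma pos_add:
  assumes "pos m + pos n < 1"
  shows "pos (m + n) = pos m + pos n"
  using assms unfolding pos_def by (simp add: distrib_right frac_add)

lemma pos_shift:
  assumes "0 \<le> pos n + real i * sqrt 2 - of_int c" "pos n + real i * sqrt 2 - of_int c < 1"
  shows "pos (n + i) = pos n + real i * sqrt 2 - of_int c"
proof (rule pos_eqI[OF _ assms])
  show "real (n + i) * sqrt 2
      = pos n + real i * sqrt 2 - of_int c + of_int (int (whole n) + c)"
    using whole_eq[of n] by (simp add: algebra_simps)
qed

lemma pos_inflate: "pos (inflate n) = (3 - 2 * sqrt 2) * pos n"
proof -
  have eq: "real (inflate n) * sqrt 2
      = (3 - 2 * sqrt 2) * pos n + of_int (4 * int n + 3 * int (whole n))"
    unfolding inflate_def by (simp add: whole_eq algebra_simps)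
  have "(3 - 2 * sqrt 2) * pos n < 1 * 1"
    using sqrt2_tight pos_bounds[of n] by (intro mult_strict_mono) auto
  then show ?thesis
    using sqrt2_tight pos_bounds[of n] by (intro pos_eqI[OF eq]) auto
qed

lemma inflate_ge: "5 * n \<le> inflate n"
proof -
  have "real n * 1 \<le> real n * sqrt 2" by (intro mult_left_mono) auto
  then have "n \<le> whole n" by (simp add: whole_def le_nat_floor)
  then show ?thesis by (simp add: inflate_def)
qed

lemma inflate_add:
  assumes "pos m + pos n < 1"
  shows "inflate (m + n) = inflate m + inflate n"
proof -
  have "real (whole (m + n)) = real (whole m + whole n)"
    by (simp add: whole_eq pos_add[OF assms] algebra_simps)
  then have "whole (m + n) = whole m + whole n" by (simp only: of_nat_eq_iff)
  then show ?thesis by (simp add: inflate_def)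
qed

text \<open>The inverse unit \<open>3 + 2 \<surd>2\<close> undoes an inflation, provided that the stretched fractional part
is still below 1.\<close>

lemma inflate_preimage:
  assumes "pos k < 3 - 2 * sqrt 2"
  obtains k' where "k = inflate k'"
proof -
  define m where "m = whole k"
  have m: "real m = real k * sqrt 2 - pos k"
    by (simp only: m_def whole_eq)
  have "real k * sqrt 2 \<le> real k * (3 / 2)"
    using sqrt2_tight by (intro mult_left_mono) auto
  then have le: "2 * m \<le> 3 * k"
    using m pos_bounds[of k] by linarith
  define k' where "k' = 3 * k - 2 * m"
  have rk': "real k' = 3 * real k - 2 * real m" using le by (simp add: k'_def)
  have "(3 + 2 * sqrt 2) * pos k < (3 + 2 * sqrt 2) * (3 - 2 * sqrt 2)"
    using assms by (intro mult_strict_left_mono) (auto intro: add_pos_pos)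
  also have "\<dots> = 1" by (simp add: algebra_simps)
  finally have lt: "(3 + 2 * sqrt 2) * pos k < 1" .
  have k'pos: "pos k' = (3 + 2 * sqrt 2) * pos k"
  proof (rule pos_eqI[OF _ _ lt])
    show "real k' * sqrt 2 = (3 + 2 * sqrt 2) * pos k + of_int (3 * int m - 4 * int k)"
      by (simp add: rk' m algebra_simps)
    show "0 \<le> (3 + 2 * sqrt 2) * pos k" using pos_bounds[of k] by simp
  qed
  have "real (inflate k') = 3 * real k' + 2 * (real k' * sqrt 2 - pos k')"
    unfolding inflate_def by (simp only: of_nat_add of_nat_mult whole_eq of_nat_numeral)
  also have "\<dots> = real k"
    unfolding k'pos by (simp add: rk' m algebra_simps)
  finally have "k = inflate k'" by simp
  then show thesis by (rule that)
qed

section \<open>Self-similarity of the walk\<close>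

lemma pos_1: "pos 1 = sqrt 2 - 1"
  using sqrt2_tight by (intro pos_eqI[where c = 1]) auto

lemma pos_2: "pos 2 = 2 * sqrt 2 - 2"
  using sqrt2_tight by (intro pos_eqI[where c = 2]) auto

lemma excess_simps [simp]: "excess 0 = 0" "excess (Suc n) = excess n + side n"
  by (simp_all add: excess_def)

text \<open>The images of the thresholds \<open>1/2\<close>, \<open>2 - \<surd>2\<close> and \<open>1\<close> under scaling, written as linear
expressions in \<open>\<surd>2\<close>, so that the sides near an inflated index are decided by linear arithmetic.\<close>

lemma inflated_block_bounds:
  shows "pos n < 1 / 2 \<longleftrightarrow> pos (inflate n) < 3 / 2 - sqrt 2"
    and "pos n < 2 - sqrt 2 \<longleftrightarrow> pos (inflate n) < 10 - 7 * sqrt 2"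
    and "pos (inflate n) < 3 - 2 * sqrt 2"
proof -
  have u: "0 < 3 - 2 * sqrt 2" using sqrt2_tight by simp
  have *: "pos n < t \<longleftrightarrow> pos (inflate n) < (3 - 2 * sqrt 2) * t" for t
    using u by (simp add: pos_inflate)
  show "pos n < 1 / 2 \<longleftrightarrow> pos (inflate n) < 3 / 2 - sqrt 2"
    using *[of "1/2"] by (simp add: algebra_simps)
  show "pos n < 2 - sqrt 2 \<longleftrightarrow> pos (inflate n) < 10 - 7 * sqrt 2"
    using *[of "2 - sqrt 2"] by (simp add: algebra_simps)
  show "pos (inflate n) < 3 - 2 * sqrt 2"
    using *[of 1] pos_bounds[of n] by simp
qed

lemma excess_prefixes: "excess (n + 1) = excess n + side n"
  "excess (n + 2) = excess n + side n + side (n + 1)"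
  "excess (n + 3) = excess n + side n + side (n + 1) + side (n + 2)"
  "excess (n + 5) = excess n + side n + side (n + 1) + side (n + 2) + side (n + 3) + side (n + 4)"
  "excess (n + 7) = excess (n + 5) + side (n + 5) + side (n + 6)"
  by (simp_all add: eval_nat_numeral)

lemma pos_block:
  assumes "pos N < 3 - 2 * sqrt 2"
  shows "pos (N + 1) = pos N + sqrt 2 - 1"
    and "pos (N + 2) = pos N + 2 * sqrt 2 - 2"
    and "pos (N + 3) = pos N + 3 * sqrt 2 - 4"
    and "pos (N + 4) = pos N + 4 * sqrt 2 - 5"
    and "pos (N + 5) = pos N + 5 * sqrt 2 - 7"
    and "10 - 7 * sqrt 2 \<le> pos N \<Longrightarrow> pos (N + 6) = pos N + 6 * sqrt 2 - 8"
  using assms sqrt2_tight pos_bounds[of N]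
    pos_shift[of N 1 1] pos_shift[of N 2 2] pos_shift[of N 3 4] pos_shift[of N 4 5]
    pos_shift[of N 5 7] pos_shift[of N 6 8]
  by simp_all

text \<open>The step from \<open>n\<close> to \<open>n + 1\<close> becomes, after inflation, a block of 5 or 7 steps, the time of the
first return of the rotation by \<open>\<surd>2\<close> to \<open>[0, 3 - 2 \<surd>2)\<close>. Writing + and - for the two sides, the
block is \<open>++-+-\<close> when \<open>n\<close> has side 1, and \<open>+--+-\<close> or \<open>+--+-+-\<close> when it has side -1. The sum of
each block is the side of \<open>n\<close>, so that the invariance follows by induction.\<close>

lemma excess_inflate: "excess (inflate n) = excess n"
proof (induction n)
  case 0
  then show ?case by (simp add: inflate_def whole_def)
next
  case (Suc n)
  define N where "N = inflate n"
  note b = inflated_block_bounds[of n, folded N_def]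
  note p = pos_block[OF b(3)] and w = sqrt2_tight pos_bounds[of N]
  have "excess (inflate (Suc n)) = excess N + side n"
  proof (cases "pos n < 2 - sqrt 2")
    case True
    then have "pos (Suc n) = pos n + sqrt 2 - 1"
      using pos_add[of n 1] pos_1 by simp
    then have "real (inflate (Suc n)) = real (N + 5)"
      unfolding N_def inflate_def of_nat_add of_nat_mult whole_eq
      by (simp add: algebra_simps)
    then have "inflate (Suc n) = N + 5" by linarith
    moreover have "excess (N + 5) = excess N + side n"
      unfolding excess_prefixes side_def p b(1) using b(3) w by simp
    ultimately show ?thesis by simp
  next
    case False
    then have "pos n \<ge> 1 / 2" "10 - 7 * sqrt 2 \<le> pos N" using b(2) w by auto
    have "pos (Suc n) = pos n + sqrt 2 - 2"
      using pos_shift[of n 1 2] False w pos_bounds[of n] by simp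
    then have "real (inflate (Suc n)) = real (N + 7)"
      unfolding N_def inflate_def of_nat_add of_nat_mult whole_eq
      by (simp add: algebra_simps)
    then have "inflate (Suc n) = N + 7" by linarith
    moreover have "excess (N + 7) = excess N + side n"
      unfolding excess_prefixes side_def p(1-5) p(6)[OF \<open>10 - 7 * sqrt 2 \<le> pos N\<close>] b(1)
      using b(3) w \<open>10 - 7 * sqrt 2 \<le> pos N\<close> by simp
    ultimately show ?thesis by simp
  qed
  then show ?case using Suc by (simp add: N_def)
qed

text \<open>Every block starts with an upward step, and the second index of the block is on the side of
the original index. Thus \<open>n \<mapsto> inflate n + 1\<close> raises the walk by one and keeps the side.\<close>

lemma inflate_successor:
  shows "excess (inflate n + 1) = excess n + 1"
    and "pos (inflate n + 1) < 1 / 2 \<longleftrightarrow> pos n < 1 / 2"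
proof -
  note b = inflated_block_bounds[of n]
  show "excess (inflate n + 1) = excess n + 1"
    using b(3) sqrt2_tight by (simp add: excess_inflate side_def)
  show "pos (inflate n + 1) < 1 / 2 \<longleftrightarrow> pos n < 1 / 2"
    unfolding pos_block(1)[OF b(3)] b(1) by linarith
qed

section \<open>Heights and separating pairs\<close>

lemma excess_2: "excess 2 = 2" "pos 2 \<ge> 1 / 2"
  using pos_1 pos_2 sqrt2_tight by (simp_all add: numeral_2_eq_2 side_def pos_def)

text \<open>The height 2 occurs at the index 2, whose side is -1; from there the map
\<open>n \<mapsto> inflate n + 1\<close> climbs one unit at a time.\<close>

lemma excess_surj:
  assumes "e \<ge> 1"
  shows "\<exists>n>0. excess n = e"
proof (cases "e = 1")
  case True
  then have "excess 1 = e" by (simp add: side_def pos_def)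
  then show ?thesis by (intro exI[of _ 1]) simp
next
  case False
  with assms have "e \<ge> 2" by simp
  then have "\<exists>n>0. excess n = e \<and> pos n \<ge> 1 / 2"
  proof (induction rule: int_ge_induct)
    case base
    show ?case using excess_2 by (intro exI[of _ 2]) simp
  next
    case (step e)
    then obtain n where "excess n = e" "pos n \<ge> 1 / 2" by auto
    then show ?case using inflate_successor[of n] by (intro exI[of _ "inflate n + 1"]) auto
  qed
  then show ?thesis by blast
qed

lemma excess_le:
  assumes "n \<ge> 3"
  shows "excess n \<le> int n - 2"
  using assms
proof (induction n rule: dec_induct)
  case base
  then show ?case using excess_2 by (simp add: eval_nat_numeral side_def)
next
  case (step n)
  then show ?case by (simp add: side_def)
qed

text \<open>If \<open>{k \<surd>2}\<close> is at least \<open>3/2 - \<surd>2\<close>, then \<open>n = 1\<close> works: adding \<open>k\<close> carries \<open>\<surd>2 - 1\<close> past \<open>1/2\<close>.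
Otherwise only indices with fractional part just below \<open>1/2\<close> are candidates, and these may be
large; but then \<open>k\<close> is the inflation of a smaller \<open>k'\<close>, and a witness \<open>n'\<close> for \<open>k'\<close> gives the
witness \<open>inflate n' + 1\<close> for \<open>k\<close>. The inequality survives because the two heights grow by 2 in
total whereas the distance grows from \<open>k'\<close> to at least \<open>5 k'\<close>. The slack of 2 for
\<open>k = 1\<close> makes \<open>n = 1\<close> a valid start there too, and one inflation absorbs it.\<close>

lemma separating_pair_side_a:
  assumes "k > 0" "pos k < 1 / 2"
  shows "\<exists>n. pos n < 1 / 2 \<and> pos (n + k) \<ge> 1 / 2
    \<and> excess n + excess (n + k) \<le> int k + (if k = 1 then 2 else 0)"
  using assms
proof (induction k rule: less_induct)
  case (less k)
  show ?case
  proof (cases "pos k < 3 / 2 - sqrt 2")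
    case False
    have "pos (1 + k) = sqrt 2 - 1 + pos k"
      using less.prems sqrt2_tight pos_add[of 1 k] pos_1 by simp
    moreover have "excess 1 = 1" by (simp add: side_def pos_def)
    moreover have "excess (1 + k) \<le> int k + (if k = 1 then 2 else 0) - 1"
    proof (cases "k = 1")
      case True
      then show ?thesis using excess_2 by (simp add: numeral_2_eq_2)
    next
      case False
      then show ?thesis using less.prems excess_le[of "1 + k"] by simp
    qed
    ultimately show ?thesis
      using False sqrt2_tight pos_1 by (intro exI[of _ 1]) simp
  next
    case True
    then obtain k' where k': "k = inflate k'"
      using inflate_preimage[of k] sqrt2_tight by auto
    have "k' > 0" using less.prems(1) k' by (cases k') (auto simp: inflate_def whole_def)
    have "pos k' < 1 / 2" using True inflated_block_bounds(1)[of k'] k' by simp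
    have "k' < k" using inflate_ge[of k'] \<open>k' > 0\<close> k' by linarith
    from less.IH[OF this \<open>k' > 0\<close> \<open>pos k' < 1 / 2\<close>] obtain n where
      n: "pos n < 1 / 2" "pos (n + k') \<ge> 1 / 2"
        "excess n + excess (n + k') \<le> int k' + (if k' = 1 then 2 else 0)" by blast
    have "inflate n + 1 + k = inflate (n + k') + 1"
      using inflate_add[of n k'] n(1) \<open>pos k' < 1 / 2\<close> k' by simp
    moreover have "int k' + (if k' = 1 then 2 else 0) + 2 \<le> int k"
      using inflate_ge[of k'] \<open>k' > 0\<close> k' by auto
    ultimately show ?thesis
      using inflate_successor[of n] inflate_successor[of "n + k'"] n
      by (intro exI[of _ "inflate n + 1"]) (auto simp del: excess_simps)
  qed
qed

text \<open>If \<open>k\<close> itself has side -1, the index \<open>n = 0\<close> serves, which has side 1 and height 0.\<close>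

lemma separating_pair:
  assumes "k \<ge> 2"
  shows "\<exists>n. pos n < 1 / 2 \<and> pos (n + k) \<ge> 1 / 2 \<and> excess n + excess (n + k) \<le> int k"
proof (cases "pos k < 1 / 2")
  case True
  then show ?thesis using separating_pair_side_a[of k] assms by auto
next
  case False
  have "excess k \<le> int k" by (cases "k = 2") (use excess_2 excess_le[of k] assms in auto)
  then show ?thesis using False by (intro exI[of _ 0]) (simp add: pos_def)
qed

section \<open>From heights to ranks\<close>

text \<open>The constant 2 in the first equation and its absence in the second come from the index 0,
which contributes to the walk and to the length \<open>n\<close> but lies in neither set.\<close>

lemma excess_card:
  assumes "n > 0"
  shows "excess n = 2 * int (card {i \<in> setA. i < n}) + 2 - int n"
    and "excess n = int n - 2 * int (card {i \<in> setB. i < n})"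
proof -
  have "excess n = 2 * int (card {i \<in> setA. i < n}) + 2 - int n
    \<and> excess n = int n - 2 * int (card {i \<in> setB. i < n})"
    using assms
  proof (induction n rule: nat_induct_non_zero)
    case 1
    have "{i \<in> setA. i < 1} = {}" "{i \<in> setB. i < 1} = {}" by (auto simp: setA_def setB_def)
    then show ?case by (simp add: side_def pos_def)
  next
    case (Suc n)
    have split: "{i \<in> S. i < Suc n} = (if n \<in> S then insert n {i \<in> S. i < n} else {i \<in> S. i < n})"
      for S by (auto simp: less_Suc_eq)
    have "n \<in> setA \<longleftrightarrow> pos n < 1 / 2" "n \<in> setB \<longleftrightarrow> pos n \<ge> 1 / 2"
      using Suc by (auto simp: setA_def setB_def pos_def)
    then show ?case using Suc.IH by (auto simp: split side_def)
  qed
  then show "excess n = 2 * int (card {i \<in> setA. i < n}) + 2 - int n"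
    "excess n = int n - 2 * int (card {i \<in> setB. i < n})" by auto
qed

lemma enumerate_card_below:
  fixes S :: "nat set"
  assumes "infinite S" "s \<in> S"
  shows "enumerate S (card {t \<in> S. t < s}) = s"
proof -
  obtain r where r: "s = enumerate S r" using enumerate_Ex[OF assms] by blast
  have "{t \<in> S. t < s} = enumerate S ` {..<r}"
    unfolding r using assms(1)
    by (auto simp: enumerate_in_set image_iff) (metis enumerate_Ex enumerate_mono_iff lessThan_iff)
  moreover have "inj_on (enumerate S) {..<r}"
    using inj_enumerate[OF assms(1)] by (rule inj_on_subset) simp
  ultimately show ?thesis by (simp add: card_image r)
qed

text \<open>Heights of the walk translate into ranks: the last hypothesis says that as many elements
of the first sequence precede \<open>M\<close> as elements of the second precede \<open>M + k\<close>.\<close>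

lemma balanced_pair_same_index:
  assumes "M > 0" "pos M < 1 / 2" "pos (M + k) \<ge> 1 / 2"
    and "excess M + excess (M + k) = int k + 2"
  shows "\<exists>j>0. seq_a j = M \<and> seq_b j = M + k"
proof -
  have M: "M \<in> setA" "M + k \<in> setB"
    using assms by (auto simp: setA_def setB_def pos_def)
  define r where "r = card {i \<in> setA. i < M}"
  have "r = card {i \<in> setB. i < M + k}"
    using excess_card(1)[of M] excess_card(2)[of "M + k"] assms by (simp add: r_def)
  then have "seq_a (Suc r) = M" "seq_b (Suc r) = M + k"
    using enumerate_card_below[OF infinite_setA M(1)] enumerate_card_below[OF infinite_setB M(2)]
    by (simp_all add: seq_a_def seq_b_def r_def)
  then show ?thesis by blast
qed

lemma infinite_indices_if_infinite_pairs:
  assumes "infinite {M. M > 0 \<and> pos M < 1 / 2 \<and> pos (M + k) \<ge> 1 / 2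
    \<and> excess M + excess (M + k) = int k + 2}" (is "infinite ?Ms")
  shows "infinite {j. j > 0 \<and> int (seq_b j) - int (seq_a j) = int k}" (is "infinite ?J")
proof
  assume "finite ?J"
  moreover have "?Ms \<subseteq> seq_a ` ?J"
  proof
    fix M assume "M \<in> ?Ms"
    then obtain j where "j > 0" "seq_a j = M" "seq_b j = M + k"
      using balanced_pair_same_index[of M k] by auto
    then show "M \<in> seq_a ` ?J" by auto
  qed
  ultimately show False using assms finite_surj by blast
qed

section \<open>Infinitely many balanced pairs\<close>

lemma strict_mono_iterates:
  fixes f :: "nat \<Rightarrow> nat"
  assumes "\<And>n. n > 0 \<Longrightarrow> f n > n" "m > 0"
  shows "strict_mono (\<lambda>t. (f ^^ t) m)"
proof -
  have "(f ^^ t) m > 0" for t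
    by (induction t) (use assms in \<open>auto intro: less_trans\<close>)
  then show ?thesis using assms by (simp add: strict_mono_Suc_iff)
qed

text \<open>Fractional parts that tend to 0 from above perturb each \<open>{i \<surd>2}\<close> only upwards and
arbitrarily little, and the conditions \<open>x < 1/2\<close> and \<open>x < 1\<close> are open.\<close>

lemma eventually_same_sides:
  assumes "(\<lambda>t. pos (N t)) \<longlonglongrightarrow> 0"
  shows "\<forall>\<^sub>F t in sequentially. \<forall>i\<le>L. pos (N t + i) < 1 / 2 \<longleftrightarrow> pos i < 1 / 2"
proof -
  have "\<forall>\<^sub>F t in sequentially. pos (N t + i) < 1 / 2 \<longleftrightarrow> pos i < 1 / 2" for i
  proof -
    define d where "d = (if pos i < 1 / 2 then 1 / 2 else 1) - pos i"
    have "d > 0" using pos_bounds[of i] by (simp add: d_def)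
    then have "\<forall>\<^sub>F t in sequentially. pos (N t) < d" using assms by (auto dest: order_tendstoD(2))
    then show ?thesis
    proof eventually_elim
      case (elim t)
      then have "pos (N t + i) = pos (N t) + pos i"
        using pos_bounds[of i] by (intro pos_add) (auto simp: d_def split: if_splits)
      then show ?case
        using elim pos_bounds[of "N t"] by (auto simp: d_def split: if_splits)
    qed
  qed
  then have "\<forall>\<^sub>F t in sequentially. \<forall>i\<in>{..L}. pos (N t + i) < 1 / 2 \<longleftrightarrow> pos i < 1 / 2"
    by (intro eventually_ball_finite) blast+
  then show ?thesis by (simp add: Ball_def)
qed

lemma excess_repeats:
  assumes "\<forall>i\<le>L. pos (N + i) < 1 / 2 \<longleftrightarrow> pos i < 1 / 2" "i \<le> L"
  shows "excess (N + i) = excess N + excess i"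
  using assms(2) by (induction i) (use assms(1) in \<open>auto simp: side_def\<close>)

text \<open>A separating pair \<open>(n, n + k)\<close> has heights that may sum to less than the required \<open>k + 2\<close>.
Translation by an index \<open>N\<close> with tiny fractional part and height \<open>e\<close> preserves the sides and raises
both heights by \<open>e\<close>; half the deficit is the right \<open>e\<close>. It is an integer because the height
of an index has the parity of that index, and it is at least 1 by the inequality for the pair.
Iterated inflation of one index of height \<open>e\<close> supplies infinitely many such \<open>N\<close>.\<close>

lemma infinitely_many_balanced_pairs:
  assumes "k \<ge> 2"
  shows "infinite {M. M > 0 \<and> pos M < 1 / 2 \<and> pos (M + k) \<ge> 1 / 2
    \<and> excess M + excess (M + k) = int k + 2}" (is "infinite ?Ms")
proof -
  obtain n where n: "pos n < 1 / 2" "pos (n + k) \<ge> 1 / 2" "excess n + excess (n + k) \<le> int k"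
    using separating_pair[OF assms] by blast
  have parity: "even (excess i - int i)" for i by (induction i) (auto simp: side_def)
  have "even (int k + 2 - excess n - excess (n + k))"
    using parity[of n] parity[of "n + k"] by presburger
  then obtain e where e: "int k + 2 - excess n - excess (n + k) = 2 * e" by blast
  then have "e \<ge> 1" using n(3) by linarith
  then obtain m where m: "m > 0" "excess m = e" using excess_surj by blast
  define N where "N t = (inflate ^^ t) m" for t
  have "n' < inflate n'" if "n' > 0" for n' using inflate_ge[of n'] that by linarith
  then have mono: "strict_mono N"
    unfolding N_def using m(1) by (rule strict_mono_iterates)
  have eN: "excess (N t) = e" for t
    by (induction t) (use m in \<open>auto simp: N_def excess_inflate\<close>)
  have pN: "pos (N t) = (3 - 2 * sqrt 2) ^ t * pos m" for t
    by (induction t) (auto simp: N_def pos_inflate)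
  have "(\<lambda>t. pos (N t)) \<longlonglongrightarrow> 0"
    unfolding pN using sqrt2_tight by (intro tendsto_mult_left_zero LIMSEQ_power_zero) auto
  from eventually_same_sides[OF this, of "n + k"] obtain t0 where
    t0: "\<And>t. t \<ge> t0 \<Longrightarrow> \<forall>i\<le>n + k. pos (N t + i) < 1 / 2 \<longleftrightarrow> pos i < 1 / 2"
    unfolding eventually_sequentially by blast
  have "N t + n \<in> ?Ms" if "t \<ge> Suc t0" for t
  proof -
    have "t \<ge> t0" "N t > 0" using that strict_mono_imp_increasing[OF mono, of t] by auto
    moreover have "excess (N t + n) = e + excess n" "excess (N t + (n + k)) = e + excess (n + k)"
      using excess_repeats[OF t0[OF \<open>t \<ge> t0\<close>]] eN by auto
    moreover have "pos (N t + n) < 1 / 2" "\<not> pos (N t + (n + k)) < 1 / 2"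
      using t0[OF \<open>t \<ge> t0\<close>] n by auto
    ultimately show ?thesis using e by (simp add: add.assoc)
  qed
  then have "(\<lambda>t. N t + n) ` {Suc t0..} \<subseteq> ?Ms" by auto
  moreover have "infinite ((\<lambda>t. N t + n) ` {Suc t0..})"
    using strict_mono_imp_inj_on[OF mono] infinite_Ici
    by (subst finite_image_iff) (auto simp: inj_on_def)
  ultimately show ?thesis using finite_subset by blast
qed

text \<open>For \<open>k = 1\<close> the pairs have to sit at an index of side 1 and height 1 followed by one of
side -1. The block of an index of side -1 starts with \<open>+--+-\<close>: counting from 0, its position 2
repeats the height and the side of that index, which yields infinitely many indices of height 2
and side -1, and its positions 3 and 4 have sides 1 and -1, the former at height one lower.\<close>

lemma infinitely_many_adjacent_pairs:
  "infinite {M. M > 0 \<and> pos M < 1 / 2 \<and> pos (M + 1) \<ge> 1 / 2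
    \<and> excess M + excess (M + 1) = int 1 + 2}" (is "infinite ?Ms")
proof -
  define h where "h n = inflate n + 2" for n
  define N where "N t = (h ^^ t) 2" for t
  have h: "n < h n" if "n > 0" for n using inflate_ge[of n] by (simp add: h_def)
  have mono: "strict_mono N"
    unfolding N_def by (rule strict_mono_iterates[OF h]) simp_all
  have *: "excess (inflate n + 2) = excess n" "pos (inflate n + 2) \<ge> 1 / 2"
      "excess (inflate n + 3) = excess n - 1"
      "pos (inflate n + 3) < 1 / 2" "pos (inflate n + 4) \<ge> 1 / 2" if "pos n \<ge> 1 / 2" for n
    unfolding excess_prefixes side_def pos_block[OF inflated_block_bounds(3)] excess_inflate
    using that inflated_block_bounds[of n] sqrt2_tight by simp_all
  have N: "excess (N t) = 2 \<and> pos (N t) \<ge> 1 / 2" for t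
    by (induction t) (use excess_2 * in \<open>auto simp: N_def h_def\<close>)
  have "N (Suc t) + 1 \<in> ?Ms" for t
  proof -
    define M where "M = inflate (N t) + 3"
    have "pos M < 1 / 2" "excess M = 1"
      using *(3,4)[of "N t"] N[of t] by (simp_all add: M_def)
    moreover have next_index: "M + 1 = inflate (N t) + 4" by (simp add: M_def)
    have "pos (M + 1) \<ge> 1 / 2"
      unfolding next_index using *(5) N by blast
    moreover have "M > 0" by (simp add: M_def)
    ultimately have "M \<in> ?Ms" by (simp add: side_def)
    moreover have "N (Suc t) + 1 = M" by (simp add: N_def h_def M_def)
    ultimately show ?thesis by (rule back_subst[where P = "\<lambda>x. x \<in> ?Ms", OF _ sym])
  qed
  then have "range (\<lambda>t. N (Suc t) + 1) \<subseteq> ?Ms" by (rule image_subsetI)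
  moreover have "inj (\<lambda>t. N (Suc t) + 1)"
    using strict_mono_eq[OF mono] by (auto intro!: injI)
  then have "infinite (range (\<lambda>t. N (Suc t) + 1))" by (rule range_inj_infinite)
  ultimately show ?thesis using finite_subset by blast
qed

theorem theorem17:
  fixes k :: int
  assumes "k > 0"
  shows "infinite {j :: nat. j > 0 \<and> int (seq_b j) - int (seq_a j) = k}"
proof -
  obtain n where n: "k = int n" "n > 0" using assms zero_less_imp_eq_int by blast
  show ?thesis
  proof (cases "n = 1")
    case True
    then show ?thesis
      using infinite_indices_if_infinite_pairs[OF infinitely_many_adjacent_pairs] n by simp
  next
    case False
    then show ?thesis
      using infinite_indices_if_infinite_pairs[OF infinitely_many_balanced_pairs[of n]] n by simp
  qed
qed

end
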